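(* The partial solvers $\mathtt{psol}$ and $\mathtt{psolB}$ are sound: for every parity game $G$, the sets $\mathrm{Win}_{\mathtt{psol}}(G,0)$ and $\mathrm{Win}_{\mathtt{psolB}}(G,0)$ are contained in the winning region of player $0$ in $G$, and the sets $\mathrm{Win}_{\mathtt{psol}}(G,1)$ and $\mathrm{Win}_{\mathtt{psolB}}(G,1)$ are contained in the winning region of player $1$ in $G$.
   Context: A parity game is a tuple $G=(V,V_0,V_1,E,c)$ where $V$ is a finite set of nodes partitioned into $V_0,V_1$, $E\subseteq V\times V$ with every node having a successor, and $c\colon V\to\mathbb{N}$. Let $v.E=\{w\mid(v,w)\in E\}$. In a play the owner of the current node chooses the next; player $0$ wins a play iff the minimal color occurring infinitely often is even, else player $1$ wins; winning regions are defined as usual. For $U\subseteq V$, $G\setminus U$ is the game restricted to $V\setminus U$. The attractor $\mathrm{Attr}_p(G,X)$ is the least fixed point of $Z\mapsto X\cup\{v\in V_p\mid v.E\cap Z\ne\emptyset\}\cup\{v\in V_{1-p}\mid v.E\subseteq Z\}$. Let $\mathrm{mpre}_p(A,X,c)=\{v\in V_p\mid c(v)\geq c \wedge v.E\cap(A\cup X)\neq\emptyset\}\cup\{v\in V_{1-p}\mid c(v)\geq c\wedge v.E\subseteq A\cup X\}$, and for a nonempty set $X$ of nodes of a common color $d$ let $\mathrm{MAttr}(X)$ be the least fixed point of $Z\mapsto\mathrm{mpre}_{d\bmod 2}(Z,X,d)$ (computed in the current game); $\mathrm{MAttr}(k):=\mathrm{MAttr}(\{k\})$. Algorithm $\mathtt{psol}(G)$: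 process the nodes $k$ of $G$ in order of non-increasing color; for each $k$: if $k\in\mathrm{MAttr}(k)$, return $\mathtt{psol}(G\setminus\mathrm{Attr}_{c(k)\bmod 2}(G,\mathrm{MAttr}(k)))$ and classify the removed set as won by player $c(k)\bmod 2$; otherwise, if some $(k,w)\in E$ has $w\in\mathrm{MAttr}(k)$, remove all such edges from $G$ and continue. If the loop ends, return $G$. Algorithm $\mathtt{psolB}(G)$: for each color $d$ of $G$ in descending order: let $X$ be the set of nodes of color $d$; repeat: if $X=\emptyset$ go to the next color; if $X\subseteq\mathrm{MAttr}(X)$, return $\mathtt{psolB}(G\setminus\mathrm{Attr}_{d\bmod 2}(G,\mathrm{MAttr}(X)))$ and classify the removed set as won by player $d\bmod 2$; else set $X:=X\cap\mathrm{MAttr}(X)$. If all colors are processed, return $G$. For a partial solver $\rho\in\{\mathtt{psol},\mathtt{psolB}\}$, $\mathrm{Win}_\rho(G,p)$ is the set of nodes of $G$ that $\rho$ classifies as won by player $p$, i.e. the union of all node sets removed (over all recursive calls) as attractors classified for player $p$. *)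

theory Defs
  imports Main "HOL-Library.Infinite_Set"
begin

section \<open>Parity games\<close>

record 'a game =
  nodes :: "'a set"
  nodes0 :: "'a set"
  nodes1 :: "'a set"
  edges :: "('a \<times> 'a) set"
  color :: "'a \<Rightarrow> nat"

definition parity_game :: "'a game \<Rightarrow> bool" where
  "parity_game G \<longleftrightarrow>
     finite (nodes G) \<and>
     nodes0 G \<union> nodes1 G = nodes G \<and> nodes0 G \<inter> nodes1 G = {} \<and>
     edges G \<subseteq> nodes G \<times> nodes G \<and>
     (\<forall>v\<in>nodes G. \<exists>w. (v, w) \<in> edges G)"

text \<open>Players are the numbers 0 and 1, so that \<open>1 - p\<close> is the opponent of \<open>p\<close> and
  \<open>d mod 2\<close> is the player favoured by color \<open>d\<close>.\<close>

definition owned :: "'a game \<Rightarrow> nat \<Rightarrow> 'a set" where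
  "owned G p = (if p = 0 then nodes0 G else nodes1 G)"

definition subgame :: "'a game \<Rightarrow> 'a set \<Rightarrow> 'a game" where
  "subgame G U = G\<lparr>nodes := nodes G - U, nodes0 := nodes0 G - U, nodes1 := nodes1 G - U,
     edges := edges G \<inter> (nodes G - U) \<times> (nodes G - U)\<rparr>"


section \<open>Plays, strategies and winning regions\<close>

definition play :: "'a game \<Rightarrow> (nat \<Rightarrow> 'a) \<Rightarrow> bool" where
  "play G \<pi> \<longleftrightarrow> (\<forall>n. (\<pi> n, \<pi> (Suc n)) \<in> edges G)"

definition min_inf_color :: "'a game \<Rightarrow> (nat \<Rightarrow> 'a) \<Rightarrow> nat" where
  "min_inf_color G \<pi> = (LEAST d. \<exists>\<^sub>\<infinity>n. color G (\<pi> n) = d)"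

definition wins :: "'a game \<Rightarrow> nat \<Rightarrow> (nat \<Rightarrow> 'a) \<Rightarrow> bool" where
  "wins G p \<pi> \<longleftrightarrow> (if p = 0 then even (min_inf_color G \<pi>) else odd (min_inf_color G \<pi>))"

text \<open>A strategy may depend on the whole history; its argument is the nonempty list of the
  nodes visited so far, the current node being the last one.\<close>

definition strategy :: "'a game \<Rightarrow> nat \<Rightarrow> ('a list \<Rightarrow> 'a) \<Rightarrow> bool" where
  "strategy G p \<sigma> \<longleftrightarrow> (\<forall>h. \<forall>v\<in>owned G p. (v, \<sigma> (h @ [v])) \<in> edges G)"

definition conforms :: "'a game \<Rightarrow> nat \<Rightarrow> ('a list \<Rightarrow> 'a) \<Rightarrow> (nat \<Rightarrow> 'a) \<Rightarrow> bool" where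
  "conforms G p \<sigma> \<pi> \<longleftrightarrow>
     (\<forall>n. \<pi> n \<in> owned G p \<longrightarrow> \<pi> (Suc n) = \<sigma> (map \<pi> [0..<Suc n]))"

definition winning_region :: "'a game \<Rightarrow> nat \<Rightarrow> 'a set" where
  "winning_region G p = {v \<in> nodes G. \<exists>\<sigma>. strategy G p \<sigma> \<and>
     (\<forall>\<pi>. play G \<pi> \<and> \<pi> 0 = v \<and> conforms G p \<sigma> \<pi> \<longrightarrow> wins G p \<pi>)}"


section \<open>Attractors and monotone attractors\<close>

definition Attr :: "'a game \<Rightarrow> nat \<Rightarrow> 'a set \<Rightarrow> 'a set" where
  "Attr G p X = lfp (\<lambda>Z. X \<union> {v \<in> owned G p. edges G `` {v} \<inter> Z \<noteq> {}}
                         \<union> {v \<in> owned G (1 - p). edges G `` {v} \<subseteq> Z})"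

definition mpre :: "'a game \<Rightarrow> nat \<Rightarrow> 'a set \<Rightarrow> 'a set \<Rightarrow> nat \<Rightarrow> 'a set" where
  "mpre G p A X d =
     {v \<in> owned G p. color G v \<ge> d \<and> edges G `` {v} \<inter> (A \<union> X) \<noteq> {}} \<union>
     {v \<in> owned G (1 - p). color G v \<ge> d \<and> edges G `` {v} \<subseteq> A \<union> X}"

text \<open>\<open>d\<close> is the common color of the nodes of \<open>X\<close>, passed explicitly.\<close>

definition MAttr :: "'a game \<Rightarrow> nat \<Rightarrow> 'a set \<Rightarrow> 'a set" where
  "MAttr G d X = lfp (\<lambda>Z. mpre G (d mod 2) Z X d)"

abbreviation MAttr_node :: "'a game \<Rightarrow> 'a \<Rightarrow> 'a set" where
  "MAttr_node G k \<equiv> MAttr G (color G k) {k}"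


section \<open>The partial solvers\<close>

text \<open>The solvers are given by their terminating runs. In \<open>psol G W R\<close> and \<open>psolB G W R\<close>,
  \<open>W p\<close> collects the nodes classified as won by player \<open>p\<close>, and \<open>R\<close> is the returned residual
  game. The order in which \<open>psol\<close> processes nodes of equal color is left open, and may be chosen
  anew in every recursive call.\<close>

definition classify :: "nat \<Rightarrow> 'a set \<Rightarrow> (nat \<Rightarrow> 'a set) \<Rightarrow> nat \<Rightarrow> 'a set" where
  "classify p A W = W(p := A \<union> W p)"

definition descending_nodes :: "'a game \<Rightarrow> 'a list \<Rightarrow> bool" where
  "descending_nodes G ks \<longleftrightarrow>
     distinct ks \<and> set ks = nodes G \<and> sorted_wrt (\<lambda>k l. color G k \<ge> color G l) ks"

text \<open>Rule \<open>psol_edges\<close> also covers the case in which there is no edge to remove.\<close>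

inductive psol :: "'a game \<Rightarrow> (nat \<Rightarrow> 'a set) \<Rightarrow> 'a game \<Rightarrow> bool"
  and psol_loop :: "'a game \<Rightarrow> 'a list \<Rightarrow> (nat \<Rightarrow> 'a set) \<Rightarrow> 'a game \<Rightarrow> bool"
where
  psol_start:
    "\<lbrakk>descending_nodes G ks; psol_loop G ks W R\<rbrakk> \<Longrightarrow> psol G W R"
| psol_end:
    "psol_loop G [] (\<lambda>_. {}) G"
| psol_hit:
    "\<lbrakk>k \<in> MAttr_node G k;
      p = color G k mod 2;
      A = Attr G p (MAttr_node G k);
      psol (subgame G A) W R\<rbrakk>
     \<Longrightarrow> psol_loop G (k # ks) (classify p A W) R"
| psol_edges:
    "\<lbrakk>k \<notin> MAttr_node G k;
      psol_loop (G\<lparr>edges := edges G - {k} \<times> MAttr_node G k\<rparr>) ks W R\<rbrakk>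
     \<Longrightarrow> psol_loop G (k # ks) W R"

definition descending_colors :: "'a game \<Rightarrow> nat list" where
  "descending_colors G = rev (sorted_list_of_set (color G ` nodes G))"

text \<open>In \<open>psolB_loop G ds W R\<close>, \<open>ds\<close> are the colors still to be processed; in
  \<open>psolB_color G d X ds W R\<close>, the color \<open>d\<close> is being processed with current set \<open>X\<close>.\<close>

inductive psolB :: "'a game \<Rightarrow> (nat \<Rightarrow> 'a set) \<Rightarrow> 'a game \<Rightarrow> bool"
  and psolB_loop :: "'a game \<Rightarrow> nat list \<Rightarrow> (nat \<Rightarrow> 'a set) \<Rightarrow> 'a game \<Rightarrow> bool"
  and psolB_color ::
    "'a game \<Rightarrow> nat \<Rightarrow> 'a set \<Rightarrow> nat list \<Rightarrow> (nat \<Rightarrow> 'a set) \<Rightarrow> 'a game \<Rightarrow> bool"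
where
  psolB_start:
    "psolB_loop G (descending_colors G) W R \<Longrightarrow> psolB G W R"
| psolB_end:
    "psolB_loop G [] (\<lambda>_. {}) G"
| psolB_next:
    "psolB_color G d {v \<in> nodes G. color G v = d} ds W R \<Longrightarrow> psolB_loop G (d # ds) W R"
| psolB_empty:
    "psolB_loop G ds W R \<Longrightarrow> psolB_color G d {} ds W R"
| psolB_hit:
    "\<lbrakk>X \<noteq> {}; X \<subseteq> MAttr G d X;
      p = d mod 2;
      A = Attr G p (MAttr G d X);
      psolB (subgame G A) W R\<rbrakk>
     \<Longrightarrow> psolB_color G d X ds (classify p A W) R"
| psolB_shrink:
    "\<lbrakk>X \<noteq> {}; \<not> X \<subseteq> MAttr G d X;
      psolB_color G d (X \<inter> MAttr G d X) ds W R\<rbrakk>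
     \<Longrightarrow> psolB_color G d X ds W R"

text \<open>The union over all runs makes \<open>Win_psol\<close> independent of the order chosen among nodes of
  equal color: containment of \<open>Win_psol G p\<close> in a set means containment for every such order.
  A run of \<open>psolB\<close> is unique. Existence and uniqueness of runs are shown below.\<close>

definition Win_psol :: "'a game \<Rightarrow> nat \<Rightarrow> 'a set" where
  "Win_psol G p = \<Union>{W p | W R. psol G W R}"

definition Win_psolB :: "'a game \<Rightarrow> nat \<Rightarrow> 'a set" where
  "Win_psolB G p = \<Union>{W p | W R. psolB G W R}"


section \<open>Existence and uniqueness of runs\<close>

lemma subset_Attr: "X \<subseteq> Attr G p X"
  unfolding Attr_def by (rule lfp_greatest) blast

lemma finite_subgame: "finite (nodes G) \<Longrightarrow> finite (nodes (subgame G A))"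
  by (simp add: subgame_def)

lemma card_subgame_less:
  assumes "finite (nodes G)" "k \<in> nodes G" "k \<in> A"
  shows "card (nodes (subgame G A)) < card (nodes G)"
  using assms by (auto simp: subgame_def intro!: psubset_card_mono)

lemma descending_nodes_exists:
  assumes "finite (nodes G)"
  shows "\<exists>ks. descending_nodes G ks"
proof -
  obtain xs where xs: "set xs = nodes G" "distinct xs"
    using finite_distinct_list[OF assms] by blast
  let ?ks = "rev (sort_key (color G) xs)"
  have "sorted (map (color G) (sort_key (color G) xs))" by simp
  then have "sorted_wrt (\<lambda>k l. color G k \<ge> color G l) ?ks"
    by (simp add: sorted_wrt_rev sorted_wrt_map)
  then have "descending_nodes G ?ks"
    using xs by (simp add: descending_nodes_def)
  then show ?thesis ..
qed

lemma psol_exists: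
  assumes "finite (nodes G)"
  shows "\<exists>W R. psol G W R"
  using assms
proof (induction "card (nodes G)" arbitrary: G rule: less_induct)
  case less
  have loop: "\<exists>W R. psol_loop H ks W R" if "nodes H = nodes G" "set ks \<subseteq> nodes G" for H ks
    using that
  proof (induction ks arbitrary: H)
    case Nil
    show ?case by (blast intro: psol_end)
  next
    case (Cons k ks)
    show ?case
    proof (cases "k \<in> MAttr_node H k")
      case True
      let ?p = "color H k mod 2"
      let ?A = "Attr H ?p (MAttr_node H k)"
      have "k \<in> ?A" by (rule subsetD[OF subset_Attr True])
      then have "card (nodes (subgame H ?A)) < card (nodes G)"
        using card_subgame_less[of H k ?A] Cons.prems less.prems by simp
      then obtain W R where "psol (subgame H ?A) W R"
        using less.hyps[of "subgame H ?A"] finite_subgame[of H] Cons.prems less.prems by auto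
      then show ?thesis using psol_hit[OF True refl refl] by blast
    next
      case False
      then show ?thesis
        using Cons.IH[of "H\<lparr>edges := edges H - {k} \<times> MAttr_node H k\<rparr>"] Cons.prems
          psol_edges[OF False] by fastforce
    qed
  qed
  obtain ks where "descending_nodes G ks"
    using descending_nodes_exists[OF less.prems] ..
  then show ?case
    using loop[of G ks] psol_start unfolding descending_nodes_def by blast
qed

lemma psolB_exists:
  assumes "finite (nodes G)"
  shows "\<exists>W R. psolB G W R"
  using assms
proof (induction "card (nodes G)" arbitrary: G rule: less_induct)
  case less
  have col: "\<exists>W R. psolB_color G d X ds W R"
    if "X \<subseteq> nodes G" "\<exists>W R. psolB_loop G ds W R" for d X ds
    using finite_subset[OF that(1) less.prems] that
  proof (induction X rule: finite_psubset_induct)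
    case (psubset X)
    consider "X = {}" | "X \<noteq> {}" "X \<subseteq> MAttr G d X" | "X \<noteq> {}" "\<not> X \<subseteq> MAttr G d X"
      by blast
    then show ?case
    proof cases
      case 1
      then show ?thesis using psubset.prems psolB_empty by blast
    next
      case 2
      let ?A = "Attr G (d mod 2) (MAttr G d X)"
      obtain k where k: "k \<in> X" using 2(1) by blast
      then have "k \<in> ?A" by (intro subsetD[OF subset_Attr] subsetD[OF 2(2)])
      then have "card (nodes (subgame G ?A)) < card (nodes G)"
        using card_subgame_less[OF less.prems subsetD[OF psubset.prems(1) k]] by simp
      then obtain W R where "psolB (subgame G ?A) W R"
        using less.hyps[of "subgame G ?A"] finite_subgame[OF less.prems] by auto
      then show ?thesis using psolB_hit[OF 2 refl refl] by blast
    next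
      case 3
      have "\<exists>W R. psolB_color G d (X \<inter> MAttr G d X) ds W R"
        using 3 psubset.prems by (intro psubset.IH) auto
      then show ?thesis using psolB_shrink[OF 3] by blast
    qed
  qed
  have "\<exists>W R. psolB_loop G ds W R" for ds
  proof (induction ds)
    case Nil
    show ?case by (blast intro: psolB_end)
  next
    case (Cons d ds)
    then show ?case using col[of "{v \<in> nodes G. color G v = d}" ds d] psolB_next by blast
  qed
  then show ?case using psolB_start by blast
qed

lemma psolB_unique_aux:
  "psolB G W R \<Longrightarrow> \<forall>W' R'. psolB G W' R' \<longrightarrow> W' = W \<and> R' = R"
  "psolB_loop G ds W R \<Longrightarrow> \<forall>W' R'. psolB_loop G ds W' R' \<longrightarrow> W' = W \<and> R' = R"
  "psolB_color G d X ds W R \<Longrightarrow>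
     \<forall>W' R'. psolB_color G d X ds W' R' \<longrightarrow> W' = W \<and> R' = R"
proof (induction rule: psolB_psolB_loop_psolB_color.inducts)
  case (psolB_start G W R)
  show ?case
  proof (intro allI impI)
    fix W' R' assume "psolB G W' R'"
    then show "W' = W \<and> R' = R"
      using psolB_start.IH by cases blast
  qed
next
  case (psolB_end G)
  show ?case
  proof (intro allI impI)
    fix W' R' assume "psolB_loop G [] W' R'"
    then show "W' = (\<lambda>_. {}) \<and> R' = G"
      by cases simp_all
  qed
next
  case (psolB_next G d ds W R)
  show ?case
  proof (intro allI impI)
    fix W' R' assume "psolB_loop G (d # ds) W' R'"
    then show "W' = W \<and> R' = R"
      using psolB_next.IH by cases blast
  qed
next
  case (psolB_empty G ds W R d)
  show ?case
  proof (intro allI impI)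
    fix W' R' assume "psolB_color G d {} ds W' R'"
    then show "W' = W \<and> R' = R"
      using psolB_empty.IH by cases blast+
  qed
next
  case (psolB_hit X G d p A W R ds)
  show ?case
  proof (intro allI impI)
    fix W' R' assume "psolB_color G d X ds W' R'"
    then show "W' = classify p A W \<and> R' = R"
      using psolB_hit.IH psolB_hit.hyps by cases simp_all
  qed
next
  case (psolB_shrink X G d ds W R)
  show ?case
  proof (intro allI impI)
    fix W' R' assume "psolB_color G d X ds W' R'"
    then show "W' = W \<and> R' = R"
      using psolB_shrink.IH psolB_shrink.hyps by cases simp_all
  qed
qed

lemma psolB_unique: "psolB G W R \<Longrightarrow> psolB G W' R' \<Longrightarrow> W' = W \<and> R' = R"
  using psolB_unique_aux(1) by blast

end

theory Submission
  imports Defs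
begin

text \<open>Inside a monotone attractor of \<open>X\<close>, the player favoured by the color \<open>d\<close> of \<open>X\<close> can force
  the play to \<open>X\<close> over colors at least \<open>d\<close>; if \<open>X\<close> lies in its own monotone attractor, repeating
  this forever wins. Removing an attractor of won nodes is harmless because it can only be entered
  from outside by the player who loses there. Removing the edges from \<open>k\<close> into its monotone
  attractor is harmless because only the opponent of the favoured player could use them, and each use
  can be answered by a forced return to \<open>k\<close> over colors at least that of \<open>k\<close>: cutting
  these excursions out of a play with infinitely many other moves does not change the least color
  seen infinitely often, and a play that ends up in excursions only is won by the favoured player.\<close>

section \<open>Parity games and plays\<close>

lemma owned_cases:
  assumes "parity_game G" "v \<in> nodes G"
  shows "v \<in> owned G p \<or> v \<in> owned G (1 - p)"
  using assms by (auto simp: parity_game_def owned_def)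

lemma owned_disjoint:
  assumes "parity_game G" "p < 2"
  shows "owned G p \<inter> owned G (1 - p) = {}"
  using assms by (auto simp: parity_game_def owned_def less_2_cases_iff)

lemma owned_subset_nodes: "parity_game G \<Longrightarrow> owned G p \<subseteq> nodes G"
  by (auto simp: parity_game_def owned_def)

lemma edge_nodes: "parity_game G \<Longrightarrow> (v, w) \<in> edges G \<Longrightarrow> v \<in> nodes G \<and> w \<in> nodes G"
  by (auto simp: parity_game_def)

lemma ex_successor: "parity_game G \<Longrightarrow> v \<in> nodes G \<Longrightarrow> \<exists>w. (v, w) \<in> edges G"
  by (auto simp: parity_game_def)

section \<open>The least color seen infinitely often\<close>

lemma wins_iff: "p < 2 \<Longrightarrow> wins G p \<pi> \<longleftrightarrow> min_inf_color G \<pi> mod 2 = p"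
  by (auto simp: wins_def less_2_cases_iff even_iff_mod_2_eq_zero odd_iff_mod_2_eq_one)

lemma wins_cong: "color H = color G \<Longrightarrow> wins H p \<pi> = wins G p \<pi>"
  by (simp add: wins_def min_inf_color_def)

lemma min_inf_color_le: "\<exists>\<^sub>\<infinity>n. color G (\<pi> n) = d \<Longrightarrow> min_inf_color G \<pi> \<le> d"
  unfolding min_inf_color_def by (rule Least_le)

lemma min_inf_color_eqI:
  assumes "\<exists>\<^sub>\<infinity>n. color G (\<pi> n) = d"
    and "\<And>e. \<exists>\<^sub>\<infinity>n. color G (\<pi> n) = e \<Longrightarrow> d \<le> e"
  shows "min_inf_color G \<pi> = d"
  unfolding min_inf_color_def using assms by (rule Least_equality)

text \<open>A play stays in the finite node set, so by pigeonhole some color recurs; hence the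
  \<open>LEAST\<close> in \<open>min_inf_color\<close> is attained.\<close>

lemma min_inf_color_INFM:
  assumes "parity_game G" "play G \<pi>"
  shows "\<exists>\<^sub>\<infinity>n. color G (\<pi> n) = min_inf_color G \<pi>"
proof -
  have "range (\<lambda>n. color G (\<pi> n)) \<subseteq> color G ` nodes G"
    using assms(2) edge_nodes[OF assms(1)] by (auto simp: play_def)
  moreover have "finite (color G ` nodes G)"
    using assms(1) by (simp add: parity_game_def)
  ultimately have "finite (range (\<lambda>n. color G (\<pi> n)))"
    by (rule finite_subset)
  then obtain m where "infinite {n. color G (\<pi> n) = color G (\<pi> m)}"
    using pigeonhole_infinite[of UNIV "\<lambda>n. color G (\<pi> n)"] by auto
  then have "\<exists>\<^sub>\<infinity>n. color G (\<pi> n) = color G (\<pi> m)"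
    by (simp add: INFM_iff_infinite)
  then show ?thesis
    unfolding min_inf_color_def by (rule LeastI)
qed

text \<open>Prefix independence of the winning condition, which lets a player change strategy in the
  middle of a play.\<close>

lemma min_inf_color_shift: "min_inf_color G (\<lambda>n. \<pi> (n + i)) = min_inf_color G \<pi>"
proof -
  have "(\<exists>\<^sub>\<infinity>n. color G (\<pi> (n + i)) = d) \<longleftrightarrow> (\<exists>\<^sub>\<infinity>n. color G (\<pi> n) = d)" for d
    unfolding frequently_def cofinite_eq_sequentially
    using eventually_sequentially_seg[of "\<lambda>n. color G (\<pi> n) \<noteq> d" i] by simp
  then show ?thesis by (simp add: min_inf_color_def)
qed


section \<open>Sufficient conditions for winning\<close>

text \<open>Unlike \<^const>\<open>conforms\<close>, this lets the play ignore illegal proposals of \<open>\<sigma>\<close>, so that \<open>\<sigma>\<close> need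
  not be a strategy on histories that never arise.\<close>

definition follows :: "'a game \<Rightarrow> nat \<Rightarrow> ('a list \<Rightarrow> 'a) \<Rightarrow> (nat \<Rightarrow> 'a) \<Rightarrow> bool" where
  "follows G p \<sigma> \<pi> \<longleftrightarrow>
     (\<forall>n. \<pi> n \<in> owned G p \<longrightarrow> (\<pi> n, \<sigma> (map \<pi> [0..<Suc n])) \<in> edges G \<longrightarrow>
        \<pi> (Suc n) = \<sigma> (map \<pi> [0..<Suc n]))"

lemma followsD:
  "follows G p \<sigma> \<pi> \<Longrightarrow> \<pi> n \<in> owned G p \<Longrightarrow> (\<pi> n, \<sigma> (map \<pi> [0..<Suc n])) \<in> edges G \<Longrightarrow>
     \<pi> (Suc n) = \<sigma> (map \<pi> [0..<Suc n])"
  unfolding follows_def by blast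

text \<open>Any function \<open>\<sigma>\<close> is repaired to a strategy by putting an arbitrary
  legal move in place of each illegal proposal.\<close>

lemma winning_regionI:
  assumes G: "parity_game G" and v: "v \<in> nodes G"
    and win: "\<And>\<pi>. play G \<pi> \<Longrightarrow> \<pi> 0 = v \<Longrightarrow> follows G p \<sigma> \<pi> \<Longrightarrow> wins G p \<pi>"
  shows "v \<in> winning_region G p"
proof -
  define \<tau> where "\<tau> h = (if (last h, \<sigma> h) \<in> edges G then \<sigma> h
    else SOME w. (last h, w) \<in> edges G)" for h
  have "strategy G p \<tau>"
    unfolding strategy_def
  proof (intro allI ballI)
    fix h u assume "u \<in> owned G p"
    then have "\<exists>w. (u, w) \<in> edges G"
      using owned_subset_nodes[OF G] ex_successor[OF G] by blast
    then show "(u, \<tau> (h @ [u])) \<in> edges G"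
      by (auto simp: \<tau>_def intro: someI_ex)
  qed
  moreover have "follows G p \<sigma> \<pi>" if "conforms G p \<tau> \<pi>" for \<pi>
    using that by (auto simp: conforms_def follows_def \<tau>_def)
  ultimately show ?thesis
    using v win unfolding winning_region_def by blast
qed

lemma winning_regionE:
  assumes "v \<in> winning_region G p"
  obtains \<sigma> where "strategy G p \<sigma>"
    "\<And>\<pi>. play G \<pi> \<Longrightarrow> \<pi> 0 = v \<Longrightarrow> conforms G p \<sigma> \<pi> \<Longrightarrow> wins G p \<pi>"
  using assms unfolding winning_region_def by blast

lemma winning_region_subset_nodes: "winning_region G p \<subseteq> nodes G"
  by (auto simp: winning_region_def)

lemma strategy_edge:
  assumes "strategy G p \<sigma>" "h \<noteq> []" "last h \<in> owned G p"
  shows "(last h, \<sigma> h) \<in> edges G"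
  using assms append_butlast_last_id[OF assms(2)] unfolding strategy_def by metis

text \<open>The history as seen by a player who forgets everything before time \<open>i\<close>, the
  first time at which \<open>P\<close> fails.\<close>

lemma dropWhile_map_upt:
  assumes "\<And>j. j < i \<Longrightarrow> P (f j)" "\<not> P (f i)"
  shows "dropWhile P (map f [0..<Suc (n + i)]) = map (\<lambda>j. f (j + i)) [0..<Suc n]"
proof -
  have "[0..<Suc (n + i)] = [0..<i] @ map (\<lambda>j. j + i) [0..<Suc n]"
    using upt_add_eq_append[of 0 i "Suc n"] by (simp add: map_add_upt add.commute del: upt_Suc)
  then have "map f [0..<Suc (n + i)] = map f [0..<i] @ map (\<lambda>j. f (j + i)) [0..<Suc n]"
    by (simp add: o_def del: upt_Suc)
  also have "dropWhile P \<dots> = dropWhile P (map (\<lambda>j. f (j + i)) [0..<Suc n])"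
    using assms(1) by (intro dropWhile_append2) auto
  also have "\<dots> = map (\<lambda>j. f (j + i)) [0..<Suc n]"
    using assms(2) by (simp add: upt_conv_Cons del: upt_Suc)
  finally show ?thesis .
qed

text \<open>On entering the winning region, a player can forget the past and switch to a strategy
  that wins from there.\<close>

lemma winning_regionI_avoid:
  assumes G: "parity_game G" and v: "v \<in> nodes G"
    and win: "\<And>\<pi>. play G \<pi> \<Longrightarrow> \<pi> 0 = v \<Longrightarrow> follows G p \<sigma> \<pi> \<Longrightarrow>
      (\<And>n. \<pi> n \<notin> winning_region G p) \<Longrightarrow> wins G p \<pi>"
  shows "v \<in> winning_region G p"
proof -
  let ?W = "winning_region G p"
  have "\<forall>w\<in>?W. \<exists>\<rho>. strategy G p \<rho> \<and>
      (\<forall>\<pi>. play G \<pi> \<and> \<pi> 0 = w \<and> conforms G p \<rho> \<pi> \<longrightarrow> wins G p \<pi>)"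
    unfolding winning_region_def by blast
  then obtain \<rho> where \<rho>: "\<And>w. w \<in> ?W \<Longrightarrow> strategy G p (\<rho> w)"
      "\<And>w \<pi>. w \<in> ?W \<Longrightarrow> play G \<pi> \<Longrightarrow> \<pi> 0 = w \<Longrightarrow> conforms G p (\<rho> w) \<pi> \<Longrightarrow> wins G p \<pi>"
    by metis
  \<comment> \<open>\<open>s\<close> is the history from its first node in \<open>?W\<close> on;
    that node, \<open>hd s\<close>, fixes which winning strategy is used from then on.\<close>
  define \<tau> where "\<tau> h = (if set h \<inter> ?W = {} then \<sigma> h
    else let s = dropWhile (\<lambda>u. u \<notin> ?W) h in \<rho> (hd s) s)" for h
  show ?thesis
  proof (rule winning_regionI[OF G v])
    fix \<pi> assume \<pi>: "play G \<pi>" "\<pi> 0 = v" "follows G p \<tau> \<pi>"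
    show "wins G p \<pi>"
    proof (cases "\<exists>n. \<pi> n \<in> ?W")
      case False
      then have "\<tau> (map \<pi> [0..<Suc n]) = \<sigma> (map \<pi> [0..<Suc n])" for n
        by (auto simp: \<tau>_def)
      then have "follows G p \<sigma> \<pi>"
        using \<pi>(3) unfolding follows_def by metis
      with False \<pi> win show ?thesis by blast
    next
      case True
      define i where "i = (LEAST n. \<pi> n \<in> ?W)"
      have i: "\<pi> i \<in> ?W" "\<And>j. j < i \<Longrightarrow> \<pi> j \<notin> ?W"
        using True by (auto simp: i_def intro: LeastI dest: not_less_Least)
      let ?\<pi> = "\<lambda>n. \<pi> (n + i)"
      have \<tau>: "\<tau> (map \<pi> [0..<Suc (n + i)]) = \<rho> (\<pi> i) (map ?\<pi> [0..<Suc n])" for n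
      proof -
        have "\<pi> i \<in> set (map \<pi> [0..<Suc (n + i)]) \<inter> ?W"
          using i(1) by (auto simp del: upt_Suc)
        moreover have "hd (map ?\<pi> [0..<Suc n]) = \<pi> i"
          by (simp add: upt_conv_Cons del: upt_Suc)
        ultimately show ?thesis
          using dropWhile_map_upt[of i "\<lambda>u. u \<notin> ?W" \<pi> n] i
          unfolding \<tau>_def Let_def by (metis empty_iff)
      qed
      have "conforms G p (\<rho> (\<pi> i)) ?\<pi>"
        unfolding conforms_def
      proof (intro allI impI)
        fix n assume o: "\<pi> (n + i) \<in> owned G p"
        have "(\<pi> (n + i), \<rho> (\<pi> i) (map ?\<pi> [0..<Suc n])) \<in> edges G"
          using strategy_edge[OF \<rho>(1)[OF i(1)], of "map ?\<pi> [0..<Suc n]"] o by simp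
        then show "\<pi> (Suc n + i) = \<rho> (\<pi> i) (map ?\<pi> [0..<Suc n])"
          using followsD[OF \<pi>(3) o] \<tau>[of n] by (simp del: upt_Suc)
      qed
      moreover have "play G ?\<pi>"
        using \<pi>(1) by (simp add: play_def)
      ultimately have "wins G p ?\<pi>"
        using \<rho>(2)[OF i(1)] by simp
      then show ?thesis
        unfolding wins_def min_inf_color_shift .
    qed
  qed
qed


section \<open>Attractors\<close>

lemma Attr_unfold:
  "Attr G p X = X \<union> {v \<in> owned G p. edges G `` {v} \<inter> Attr G p X \<noteq> {}}
     \<union> {v \<in> owned G (1 - p). edges G `` {v} \<subseteq> Attr G p X}"
proof -
  have "mono (\<lambda>Z. X \<union> {v \<in> owned G p. edges G `` {v} \<inter> Z \<noteq> {}}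
      \<union> {v \<in> owned G (1 - p). edges G `` {v} \<subseteq> Z})"
    by (rule monoI) blast
  then show ?thesis
    unfolding Attr_def by (rule lfp_unfold)
qed

lemma Attr_predecessor:
  "v \<in> owned G p \<Longrightarrow> (v, w) \<in> edges G \<Longrightarrow> w \<in> Attr G p X \<Longrightarrow> v \<in> Attr G p X"
  by (subst Attr_unfold) blast

text \<open>The winning region is closed under the attractor operator, so it contains the least
  fixed point. A first move into the region suffices, because \<open>winning_regionI_avoid\<close>
  leaves only plays that never enter it.\<close>

lemma Attr_subset_winning_region:
  assumes G: "parity_game G" and p: "p < 2" and X: "X \<subseteq> winning_region G p"
  shows "Attr G p X \<subseteq> winning_region G p"
  unfolding Attr_def
proof (rule lfp_lowerbound, intro Un_least subsetI)
  fix v assume "v \<in> X"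
  then show "v \<in> winning_region G p" using X by blast
next
  fix v assume "v \<in> {v \<in> owned G p. edges G `` {v} \<inter> winning_region G p \<noteq> {}}"
  then obtain w where w: "v \<in> owned G p" "(v, w) \<in> edges G" "w \<in> winning_region G p"
    by auto
  show "v \<in> winning_region G p"
  proof (rule winning_regionI_avoid[OF G])
    show "v \<in> nodes G" using w(2) edge_nodes[OF G] by blast
    fix \<pi> assume "\<pi> 0 = v" "follows G p (\<lambda>_. w) \<pi>"
      and "\<And>n. \<pi> n \<notin> winning_region G p"
    then show "wins G p \<pi>"
      using w followsD[of G p "\<lambda>_. w" \<pi> 0] by metis
  qed
next
  fix v assume v: "v \<in> {v \<in> owned G (1 - p). edges G `` {v} \<subseteq> winning_region G p}"
  show "v \<in> winning_region G p"
  proof (rule winning_regionI_avoid[OF G])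
    show "v \<in> nodes G" using v owned_subset_nodes[OF G] by blast
    fix \<pi> assume "play G \<pi>" "\<pi> 0 = v" "\<And>n. \<pi> n \<notin> winning_region G p"
    then show "wins G p \<pi>"
      using v unfolding play_def by blast
  qed
qed

section \<open>Subgames left after the removal of an attractor\<close>

lemma owned_subgame: "owned (subgame G A) p = owned G p - A"
  by (simp add: owned_def subgame_def)

lemma color_subgame: "color (subgame G A) = color G"
  by (simp add: subgame_def)

lemma nodes_subgame: "nodes (subgame G A) = nodes G - A"
  by (simp add: subgame_def)

lemma edges_subgame: "edges (subgame G A) = edges G \<inter> (nodes G - A) \<times> (nodes G - A)"
  by (simp add: subgame_def)

text \<open>Outside the attractor, a node of \<open>p\<close> has no successor inside and a node of
  the opponent has one outside; so every remaining node keeps a successor.\<close>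

lemma parity_game_subgame_Attr:
  assumes G: "parity_game G"
  shows "parity_game (subgame G (Attr G p X))"
proof -
  let ?A = "Attr G p X"
  have "\<exists>w. (v, w) \<in> edges G \<and> w \<notin> ?A" if v: "v \<in> nodes G" "v \<notin> ?A" for v
    using owned_cases[OF G v(1), of p]
  proof
    assume "v \<in> owned G p"
    then show ?thesis
      using v ex_successor[OF G v(1)] Attr_predecessor by fast
  next
    assume "v \<in> owned G (1 - p)"
    then show ?thesis
      using v Attr_unfold[of G p X] by blast
  qed
  then show ?thesis
    using G edge_nodes[OF G] unfolding parity_game_def by (fastforce simp: subgame_def)
qed

text \<open>A strategy for the subgame never proposes a move into \<open>A\<close>, and by
  \<open>exits\<close> the opponent can enter \<open>A\<close> only where \<open>q\<close> already
  wins in \<open>G\<close>. All other plays are plays of the subgame.\<close>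

lemma winning_region_subgame:
  assumes G: "parity_game G"
    and exits: "\<And>v w. v \<in> owned G (1 - q) \<Longrightarrow> v \<notin> A \<Longrightarrow> (v, w) \<in> edges G \<Longrightarrow> w \<in> A \<Longrightarrow>
      w \<in> winning_region G q"
  shows "winning_region (subgame G A) q \<subseteq> winning_region G q"
proof
  let ?H = "subgame G A"
  fix v assume v: "v \<in> winning_region ?H q"
  then obtain \<sigma> where \<sigma>: "strategy ?H q \<sigma>"
    "\<And>\<pi>. play ?H \<pi> \<Longrightarrow> \<pi> 0 = v \<Longrightarrow> conforms ?H q \<sigma> \<pi> \<Longrightarrow> wins ?H q \<pi>"
    by (rule winning_regionE) blast
  have vn: "v \<in> nodes G - A"
    using v winning_region_subset_nodes[of ?H q] by (auto simp: nodes_subgame)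
  show "v \<in> winning_region G q"
  proof (rule winning_regionI_avoid[OF G])
    show "v \<in> nodes G" using vn by simp
    fix \<pi> assume \<pi>: "play G \<pi>" "\<pi> 0 = v" "follows G q \<sigma> \<pi>" "\<And>n. \<pi> n \<notin> winning_region G q"
    have E: "(\<pi> n, \<pi> (Suc n)) \<in> edges G" for n
      using \<pi>(1) by (simp add: play_def)
    have \<sigma>H: "\<pi> (Suc n) = \<sigma> (map \<pi> [0..<Suc n])"
        "(\<pi> n, \<pi> (Suc n)) \<in> edges ?H"
      if "\<pi> n \<notin> A" "\<pi> n \<in> owned G q" for n
    proof -
      have *: "(\<pi> n, \<sigma> (map \<pi> [0..<Suc n])) \<in> edges ?H"
        using strategy_edge[OF \<sigma>(1), of "map \<pi> [0..<Suc n]"] that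
        by (simp add: owned_subgame)
      then show "\<pi> (Suc n) = \<sigma> (map \<pi> [0..<Suc n])"
        using followsD[OF \<pi>(3) that(2)] by (simp add: edges_subgame)
      with * show "(\<pi> n, \<pi> (Suc n)) \<in> edges ?H" by simp
    qed
    have notA: "\<pi> n \<notin> A" for n
    proof (induction n)
      case 0
      then show ?case using vn \<pi>(2) by simp
    next
      case (Suc n)
      have "\<pi> n \<in> nodes G" using edge_nodes[OF G E] by blast
      from owned_cases[OF G this, of q] show ?case
      proof
        assume "\<pi> n \<in> owned G q"
        then show ?thesis using \<sigma>H(2) Suc by (auto simp: edges_subgame)
      next
        assume "\<pi> n \<in> owned G (1 - q)"
        then show ?thesis using exits Suc E \<pi>(4) by blast
      qed
    qed
    have "play ?H \<pi>"
      using E notA edge_nodes[OF G E] by (simp add: play_def edges_subgame)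
    moreover have "conforms ?H q \<sigma> \<pi>"
      using \<sigma>H(1) notA by (auto simp: conforms_def owned_subgame simp del: upt_Suc)
    ultimately have "wins ?H q \<pi>"
      using \<sigma>(2) \<pi>(2) by blast
    then show "wins G q \<pi>"
      using wins_cong[OF color_subgame, of G A q \<pi>] by simp
  qed
qed

text \<open>For \<open>q = p\<close> every exit leads to nodes won by \<open>p\<close>. For
  \<open>q\<close> the opponent there are no exits: a node of \<open>p\<close> with an edge into the
  attractor belongs to it.\<close>

lemma classify_Attr_sound:
  assumes G: "parity_game G" and p: "p < 2" and q: "q < 2"
    and X: "X \<subseteq> winning_region G p"
    and W: "W q \<subseteq> winning_region (subgame G (Attr G p X)) q"
  shows "classify p (Attr G p X) W q \<subseteq> winning_region G q"
proof -
  let ?A = "Attr G p X"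
  have A: "?A \<subseteq> winning_region G p"
    using Attr_subset_winning_region[OF G p X] .
  have "winning_region (subgame G ?A) q \<subseteq> winning_region G q"
  proof (rule winning_region_subgame[OF G])
    fix v w assume "v \<in> owned G (1 - q)" "v \<notin> ?A" "(v, w) \<in> edges G" "w \<in> ?A"
    moreover from this have "v \<notin> owned G p"
      using Attr_predecessor by fast
    ultimately show "w \<in> winning_region G q"
      using A p q by (cases "q = p") (blast, auto simp: less_2_cases_iff)
  qed
  then show ?thesis
    using A W by (auto simp: classify_def)
qed


section \<open>Monotone attractors\<close>

lemma mono_mpre: "mono (\<lambda>Z. mpre G p Z X d)"
  unfolding mpre_def by (rule monoI) blast

lemma MAttr_unfold: "MAttr G d X = mpre G (d mod 2) (MAttr G d X) X d"
  unfolding MAttr_def by (rule lfp_unfold[OF mono_mpre])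

text \<open>Compactness, needed for nodes of the opponent: their finitely many successors must all
  be covered at a common stage.\<close>

lemma finite_subset_UN_incseq:
  fixes f :: "nat \<Rightarrow> 'a set"
  assumes "finite S" "\<And>m n. m \<le> n \<Longrightarrow> f m \<subseteq> f n" "S \<subseteq> (\<Union>n. f n) \<union> X"
  shows "\<exists>n. S \<subseteq> f n \<union> X"
  using assms(1,3)
proof (induction S)
  case (insert x S)
  then obtain n m where "S \<subseteq> f n \<union> X" "x \<in> f m \<union> X" by blast
  moreover have "f n \<subseteq> f (max n m)" "f m \<subseteq> f (max n m)"
    by (simp_all add: assms(2))
  ultimately have "insert x S \<subseteq> f (max n m) \<union> X"
    by blast
  then show ?case ..
qed simp

text \<open>Finite branching makes the least fixed point the union of its finite stages, and
  \<open>r\<close> is the stage at which a node appears. This rank measures progress towards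
  \<open>X\<close>.\<close>

lemma MAttr_rank:
  assumes G: "parity_game G"
  obtains r :: "'a \<Rightarrow> nat" where
    "\<And>v. v \<in> MAttr G d X \<Longrightarrow> v \<in> mpre G (d mod 2) {w \<in> MAttr G d X. r w < r v} X d"
proof -
  define F where "F Z = mpre G (d mod 2) Z X d" for Z
  have mono: "mono F" unfolding F_def by (rule mono_mpre)
  have M: "MAttr G d X = lfp F" by (simp add: MAttr_def F_def[abs_def])
  define I where "I n = (F ^^ n) {}" for n
  have I_Suc: "I (Suc n) = F (I n)" for n by (simp add: I_def)
  have "I n \<subseteq> I (Suc n)" for n
    by (induction n) (simp add: I_def, metis I_Suc mono monoD)
  then have inc: "I m \<subseteq> I n" if "m \<le> n" for m n
    using that by (rule lift_Suc_mono_le)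
  have IM: "I n \<subseteq> lfp F" for n
    by (induction n) (simp add: I_def, metis I_Suc mono monoD lfp_unfold)
  have "F (\<Union>n. I n) \<subseteq> (\<Union>n. I n)"
  proof
    fix v assume v: "v \<in> F (\<Union>n. I n)"
    have "finite (edges G `` {v})"
      using G by (auto simp: parity_game_def intro!: finite_subset[of "edges G `` {v}" "nodes G"])
    then have "edges G `` {v} \<subseteq> (\<Union>n. I n) \<union> X \<Longrightarrow> \<exists>n. edges G `` {v} \<subseteq> I n \<union> X"
      by (rule finite_subset_UN_incseq[OF _ inc])
    then have "\<exists>n. v \<in> F (I n)"
      using v unfolding F_def mpre_def by blast
    then show "v \<in> (\<Union>n. I n)" using I_Suc by blast
  qed
  then have MI: "lfp F \<subseteq> (\<Union>n. I n)" by (rule lfp_lowerbound)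
  define r where "r v = (LEAST n. v \<in> I n)" for v
  show ?thesis
  proof (rule that[of r])
    fix v assume "v \<in> MAttr G d X"
    then have "\<exists>n. v \<in> I n" using MI M by blast
    then have v: "v \<in> I (r v)" unfolding r_def by (rule LeastI_ex)
    then obtain m where m: "r v = Suc m" by (cases "r v") (auto simp: I_def)
    have "r x < r v" if "x \<in> I m" for x
      unfolding m less_Suc_eq_le r_def[of x] using that by (rule Least_le)
    then have "I m \<subseteq> {w \<in> MAttr G d X. r w < r v}"
      using IM[of m] M by blast
    then have "F (I m) \<subseteq> F {w \<in> MAttr G d X. r w < r v}"
      using mono by (rule monoD[rotated])
    then show "v \<in> mpre G (d mod 2) {w \<in> MAttr G d X. r w < r v} X d"
      using v m I_Suc by (auto simp: F_def)
  qed
qed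

text \<open>\<open>a\<close> selects moves that enter \<open>X\<close> or lower the rank. The rank
  cannot fall forever, so a play obeying \<open>a\<close> meets \<open>X\<close>, and thus color
  \<open>d\<close>, infinitely often, while smaller colors are absent. Only the tail from
  \<open>m\<close> on is constrained, to cover plays that settle there late.\<close>

lemma MAttr_moves:
  assumes G: "parity_game G" and X: "\<And>v. v \<in> X \<Longrightarrow> color G v = d"
  obtains a where
    "\<And>v. v \<in> MAttr G d X \<Longrightarrow> v \<in> owned G (d mod 2) \<Longrightarrow>
       (v, a v) \<in> edges G \<and> a v \<in> MAttr G d X \<union> X"
    "\<And>\<pi> m. play G \<pi> \<Longrightarrow> (\<And>n. m \<le> n \<Longrightarrow> \<pi> n \<in> MAttr G d X \<union> X) \<Longrightarrow>
      (\<And>n. m \<le> n \<Longrightarrow> \<pi> n \<in> MAttr G d X \<Longrightarrow> \<pi> n \<in> owned G (d mod 2) \<Longrightarrow>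
        \<pi> (Suc n) = a (\<pi> n)) \<Longrightarrow>
      min_inf_color G \<pi> = d"
proof -
  let ?M = "MAttr G d X" and ?p = "d mod 2"
  obtain r :: "'a \<Rightarrow> nat" where r: "\<And>v. v \<in> ?M \<Longrightarrow> v \<in> mpre G ?p {w \<in> ?M. r w < r v} X d"
    using MAttr_rank[OF G, of d X] by blast
  have disj: "owned G ?p \<inter> owned G (1 - ?p) = {}"
    by (rule owned_disjoint[OF G]) simp
  define P where "P v w \<longleftrightarrow> (v, w) \<in> edges G \<and> (w \<in> X \<or> w \<in> ?M \<and> r w < r v)" for v w
  define a where "a v = (SOME w. P v w)" for v
  have a: "P v (a v)" if "v \<in> ?M" "v \<in> owned G ?p" for v
  proof -
    have "\<exists>w. P v w"
      using r[OF that(1)] that(2) disj unfolding mpre_def P_def by blast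
    then show ?thesis unfolding a_def by (rule someI_ex)
  qed
  have opp: "P v w" if "v \<in> ?M" "v \<notin> owned G ?p" "(v, w) \<in> edges G" for v w
    using r[OF that(1)] that(2,3) unfolding mpre_def P_def by blast
  have ge: "d \<le> color G v" if "v \<in> ?M \<union> X" for v
    using that r[of v] X[of v] unfolding mpre_def by auto
  show ?thesis
  proof (rule that[of a])
    fix v assume "v \<in> ?M" "v \<in> owned G ?p"
    then show "(v, a v) \<in> edges G \<and> a v \<in> ?M \<union> X"
      using a[of v] unfolding P_def by blast
  next
    fix \<pi> m
    assume play: "play G \<pi>" and stay: "\<And>n. m \<le> n \<Longrightarrow> \<pi> n \<in> ?M \<union> X"
      and foll: "\<And>n. m \<le> n \<Longrightarrow> \<pi> n \<in> ?M \<Longrightarrow> \<pi> n \<in> owned G ?p \<Longrightarrow> \<pi> (Suc n) = a (\<pi> n)"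
    have step: "P (\<pi> n) (\<pi> (Suc n))" if "m \<le> n" "\<pi> n \<in> ?M" for n
      using a[of "\<pi> n"] opp[of "\<pi> n" "\<pi> (Suc n)"] foll[OF that] that play
      unfolding play_def by metis
    have "\<exists>\<^sub>\<infinity>n. \<pi> n \<in> X"
    proof (rule ccontr)
      assume "\<not> (\<exists>\<^sub>\<infinity>n. \<pi> n \<in> X)"
      then obtain l where l: "\<And>n. l < n \<Longrightarrow> \<pi> n \<notin> X"
        by (auto simp: INFM_nat)
      \<comment> \<open>The tail past both \<open>m\<close> and every visit to \<open>X\<close>: on
        it the rank would decrease forever.\<close>
      define s where "s i = \<pi> (Suc (max l m) + i)" for i
      have "r (s (Suc i)) < r (s i)" for i
        using step[of "Suc (max l m) + i"] stay[of "Suc (max l m) + i"]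
          l[of "Suc (max l m) + i"] l[of "Suc (Suc (max l m) + i)"]
        by (auto simp: s_def P_def)
      then show False
        using wf_iff_no_infinite_down_chain[THEN iffD1, OF wf_measure[of r]] by auto
    qed
    then have inf: "\<exists>\<^sub>\<infinity>n. color G (\<pi> n) = d"
      by (rule INFM_mono) (rule X)
    show "min_inf_color G \<pi> = d"
    proof (rule min_inf_color_eqI[OF inf])
      fix e assume "\<exists>\<^sub>\<infinity>n. color G (\<pi> n) = e"
      then obtain n where "m < n" "color G (\<pi> n) = e"
        by (auto simp: INFM_nat)
      then show "d \<le> e" using ge[OF stay, of n] by simp
    qed
  qed
qed

lemma MAttr_opponent_stays:
  assumes G: "parity_game G" and v: "v \<in> MAttr G d X" "v \<notin> owned G (d mod 2)"
    and e: "(v, w) \<in> edges G"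
  shows "w \<in> MAttr G d X \<union> X"
  using v e MAttr_unfold[of G d X] unfolding mpre_def by blast

lemma MAttr_subset_nodes: "parity_game G \<Longrightarrow> MAttr G d X \<subseteq> nodes G"
  using MAttr_unfold[of G d X] owned_subset_nodes[of G] unfolding mpre_def by blast

text \<open>As \<open>X\<close> lies inside the attractor, attraction can restart after each visit
  to \<open>X\<close>: the play never leaves the attractor and revisits \<open>X\<close>
  forever.\<close>

lemma MAttr_subset_winning_region:
  assumes G: "parity_game G" and X: "\<And>v. v \<in> X \<Longrightarrow> color G v = d"
    and XM: "X \<subseteq> MAttr G d X"
  shows "MAttr G d X \<subseteq> winning_region G (d mod 2)"
proof
  let ?M = "MAttr G d X" and ?p = "d mod 2"
  obtain a where a: "\<And>v. v \<in> ?M \<Longrightarrow> v \<in> owned G ?p \<Longrightarrow> (v, a v) \<in> edges G \<and> a v \<in> ?M \<union> X"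
    and win: "\<And>\<pi> m. play G \<pi> \<Longrightarrow> (\<And>n. m \<le> n \<Longrightarrow> \<pi> n \<in> ?M \<union> X) \<Longrightarrow>
      (\<And>n. m \<le> n \<Longrightarrow> \<pi> n \<in> ?M \<Longrightarrow> \<pi> n \<in> owned G ?p \<Longrightarrow> \<pi> (Suc n) = a (\<pi> n)) \<Longrightarrow>
      min_inf_color G \<pi> = d"
    using MAttr_moves[OF G X] by blast
  fix v assume v: "v \<in> ?M"
  show "v \<in> winning_region G ?p"
  proof (rule winning_regionI[OF G, where \<sigma> = "\<lambda>h. a (last h)"])
    show "v \<in> nodes G" using v MAttr_subset_nodes[OF G] by blast
    fix \<pi> assume \<pi>: "play G \<pi>" "\<pi> 0 = v" "follows G ?p (\<lambda>h. a (last h)) \<pi>"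
    have foll: "\<pi> (Suc n) = a (\<pi> n)" if "\<pi> n \<in> ?M" "\<pi> n \<in> owned G ?p" for n
      using followsD[OF \<pi>(3) that(2)] a[OF that] by simp
    have "\<pi> n \<in> ?M" for n
    proof (induction n)
      case 0
      then show ?case using \<pi>(2) v by simp
    next
      case (Suc n)
      have "(\<pi> n, \<pi> (Suc n)) \<in> edges G" using \<pi>(1) by (simp add: play_def)
      then show ?case
        using MAttr_opponent_stays[OF G Suc] foll[OF Suc] a[OF Suc] XM by fastforce
    qed
    then have "min_inf_color G \<pi> = d"
      using win[OF \<pi>(1), of 0] foll by blast
    then show "wins G ?p \<pi>"
      by (simp add: wins_iff)
  qed
qed


section \<open>Edge removal\<close>

text \<open>\<open>cut k M\<close> deletes from a history every excursion that leaves \<open>k\<close> into \<open>M\<close>, up to the next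
  return to \<open>k\<close>; self-loops at \<open>k\<close> count as excursions. An excursion is in progress iff the last
  node of the cut history differs from the current node.\<close>

definition cut_step :: "'a \<Rightarrow> 'a set \<Rightarrow> 'a list \<Rightarrow> 'a \<Rightarrow> 'a list" where
  "cut_step k M h w = (if h \<noteq> [] \<and> last h = k \<and> w \<in> insert k M then h else h @ [w])"

definition cut :: "'a \<Rightarrow> 'a set \<Rightarrow> 'a list \<Rightarrow> 'a list" where
  "cut k M = foldl (cut_step k M) []"

text \<open>With the cut histories for \<open>H\<close>, the times \<open>t i\<close> at which a
  node is appended assemble them into one infinite play, the limit from which all excursions are
  removed.\<close>

lemma growing_lists_subseq:
  fixes H :: "nat \<Rightarrow> 'a list"
  assumes H0: "H 0 = [\<pi> 0]"
    and step: "\<And>n. H (Suc n) = H n \<or> H (Suc n) = H n @ [\<pi> (Suc n)]"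
    and grow: "\<And>n. \<exists>m\<ge>n. H (Suc m) \<noteq> H m"
  obtains t :: "nat \<Rightarrow> nat" where "strict_mono t" "t 0 = 0"
    "\<And>i j. t i \<le> j \<Longrightarrow> j < t (Suc i) \<Longrightarrow> H j = H (t i)"
    "\<And>i. H (t (Suc i)) = H (t i) @ [\<pi> (t (Suc i))]"
    "\<And>i. H (t i) = map (\<lambda>i. \<pi> (t i)) [0..<Suc i]"
proof -
  have next_time: "\<exists>m. n < m \<and> (\<forall>j. n \<le> j \<and> j < m \<longrightarrow> H j = H n) \<and> H m = H n @ [\<pi> m]" for n
  proof -
    define m where "m = (LEAST m. n \<le> m \<and> H (Suc m) \<noteq> H m)"
    have m: "n \<le> m \<and> H (Suc m) \<noteq> H m"
      unfolding m_def by (rule LeastI_ex) (use grow in blast)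
    have least: "H (Suc j) = H j" if "n \<le> j" "j < m" for j
      using that not_less_Least unfolding m_def by blast
    have "H (n + i) = H n" if "n + i \<le> m" for i
      using that by (induction i) (simp_all add: least)
    then have const: "H j = H n" if "n \<le> j" "j \<le> m" for j
      using that by (metis le_add_diff_inverse)
    have "H (Suc m) = H n @ [\<pi> (Suc m)]"
      using step[of m] m const[of m] by simp
    then show ?thesis using const m by (metis le_imp_less_Suc less_Suc_eq_le)
  qed
  have "\<exists>t. \<forall>i. (i = 0 \<longrightarrow> t i = 0) \<and> t i < t (Suc i) \<and>
      (\<forall>j. t i \<le> j \<and> j < t (Suc i) \<longrightarrow> H j = H (t i)) \<and>
      H (t (Suc i)) = H (t i) @ [\<pi> (t (Suc i))]"
    by (rule dependent_nat_choice) (use next_time in blast)+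
  then obtain t where t: "t 0 = 0" "\<And>i. t i < t (Suc i)"
    "\<And>i j. t i \<le> j \<Longrightarrow> j < t (Suc i) \<Longrightarrow> H j = H (t i)"
    "\<And>i. H (t (Suc i)) = H (t i) @ [\<pi> (t (Suc i))]"
    by blast
  have "H (t i) = map (\<lambda>i. \<pi> (t i)) [0..<Suc i]" for i
    by (induction i) (simp_all add: t H0)
  with t show ?thesis
    using that[of t] by (simp add: strict_mono_Suc_iff)
qed

section \<open>The game without the edges from \<open>k\<close> into its monotone attractor\<close>

context
  fixes G G' :: "'a game" and k :: 'a and M :: "'a set"
  assumes G: "parity_game G"
    and k_notin: "k \<notin> MAttr_node G k"
    and M_def: "M = MAttr_node G k"
    and G'_def: "G' = G\<lparr>edges := edges G - {k} \<times> M\<rparr>"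
begin

lemma owned_G': "owned G' p = owned G p"
  by (simp add: owned_def G'_def)

lemma color_G': "color G' = color G"
  by (simp add: G'_def)

lemma edges_G': "edges G' = edges G - {k} \<times> M"
  by (simp add: G'_def)

text \<open>If the favoured player owns \<open>k\<close>, a single edge into \<open>M\<close> would
  already put \<open>k\<close> into its own monotone attractor.\<close>

lemma own_node_no_edges_into_MAttr:
  assumes "k \<in> owned G (color G k mod 2)"
  shows "G' = G"
proof -
  have "edges G `` {k} \<inter> M = {}"
    using k_notin assms MAttr_unfold[of G "color G k" "{k}"] unfolding M_def mpre_def by auto
  then have "edges G - {k} \<times> M = edges G" by auto
  then show ?thesis by (simp add: G'_def)
qed

text \<open>If the opponent owns \<open>k\<close> and all its successors were in \<open>M\<close>,
  the fixed point equation would put \<open>k\<close> into \<open>M\<close>; so some edge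
  survives.\<close>

lemma parity_game_remove_edges: "parity_game G'"
proof (cases "k \<in> owned G (color G k mod 2)")
  case True
  then show ?thesis using own_node_no_edges_into_MAttr G by simp
next
  case False
  have "\<exists>w. (v, w) \<in> edges G - {k} \<times> M" if v: "v \<in> nodes G" for v
  proof (cases "v = k")
    case True
    then have "k \<in> owned G (1 - color G k mod 2)"
      using owned_cases[OF G, of k "color G k mod 2"] v False by auto
    then show ?thesis
      using True k_notin MAttr_unfold[of G "color G k" "{k}"] unfolding M_def mpre_def by blast
  next
    case False
    then show ?thesis using ex_successor[OF G v] by blast
  qed
  then show ?thesis
    using G unfolding parity_game_def G'_def by auto
qed

text \<open>Only options of \<open>q\<close> disappear, so a strategy for \<open>G'\<close> stays
  legal in \<open>G\<close>, and plays that follow it never use a removed edge.\<close>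

lemma winning_region_remove_edges_opponent:
  assumes k: "k \<notin> owned G p"
    and q: "q = 1 - p" and p: "p < 2"
  shows "winning_region G' q \<subseteq> winning_region G q"
proof
  fix v assume v: "v \<in> winning_region G' q"
  then obtain \<sigma> where \<sigma>: "strategy G' q \<sigma>"
    "\<And>\<pi>. play G' \<pi> \<Longrightarrow> \<pi> 0 = v \<Longrightarrow> conforms G' q \<sigma> \<pi> \<Longrightarrow> wins G' q \<pi>"
    by (rule winning_regionE) blast
  show "v \<in> winning_region G q"
  proof (rule winning_regionI[OF G])
    show "v \<in> nodes G"
      using v winning_region_subset_nodes[of G' q] by (auto simp: G'_def)
    fix \<pi> assume \<pi>: "play G \<pi>" "\<pi> 0 = v" "follows G q \<sigma> \<pi>"
    have E: "(\<pi> n, \<pi> (Suc n)) \<in> edges G" for n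
      using \<pi>(1) by (simp add: play_def)
    have \<sigma>E: "(\<pi> n, \<sigma> (map \<pi> [0..<Suc n])) \<in> edges G'" if "\<pi> n \<in> owned G q" for n
      using strategy_edge[OF \<sigma>(1), of "map \<pi> [0..<Suc n]"] that by (simp add: owned_G')
    have foll: "\<pi> (Suc n) = \<sigma> (map \<pi> [0..<Suc n])" if "\<pi> n \<in> owned G q" for n
      using followsD[OF \<pi>(3) that] \<sigma>E[OF that] by (simp add: edges_G')
    have "(\<pi> n, \<pi> (Suc n)) \<in> edges G'" for n
    proof (cases "\<pi> n \<in> owned G q")
      case True
      then show ?thesis using \<sigma>E foll by simp
    next
      case False
      moreover have "\<pi> n \<in> nodes G" using edge_nodes[OF G E] by blast
      ultimately have "\<pi> n \<noteq> k" using owned_cases[OF G, of "\<pi> n" p] k q by blast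
      then show ?thesis using E by (simp add: edges_G')
    qed
    then have "play G' \<pi>" by (simp add: play_def)
    moreover have "conforms G' q \<sigma> \<pi>"
      using foll by (simp add: conforms_def owned_G' del: upt_Suc)
    ultimately show "wins G q \<pi>"
      using \<sigma>(2) \<pi>(2) wins_cong[OF color_G'] by blast
  qed
qed

text \<open>Here the opponent regains edges. Player \<open>p\<close> plays \<open>\<sigma>'\<close>
  on the cut history and answers excursions with attracting moves, so that \<open>\<sigma>'\<close>
  faces only histories without removed edges.\<close>

lemma winning_region_remove_edges_own:
  assumes k: "k \<notin> owned G p" and p: "p = color G k mod 2"
  shows "winning_region G' p \<subseteq> winning_region G p"
proof
  let ?d = "color G k"
  obtain a where a: "\<And>v. v \<in> M \<Longrightarrow> v \<in> owned G p \<Longrightarrow> (v, a v) \<in> edges G \<and> a v \<in> M \<union> {k}"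
    and awin: "\<And>\<pi> m. play G \<pi> \<Longrightarrow> (\<And>n. m \<le> n \<Longrightarrow> \<pi> n \<in> M \<union> {k}) \<Longrightarrow>
      (\<And>n. m \<le> n \<Longrightarrow> \<pi> n \<in> M \<Longrightarrow> \<pi> n \<in> owned G p \<Longrightarrow> \<pi> (Suc n) = a (\<pi> n)) \<Longrightarrow>
      min_inf_color G \<pi> = ?d"
    using MAttr_moves[OF G, of "{k}" ?d] unfolding M_def p by blast
  have kM: "k \<notin> M" using k_notin by (simp add: M_def)
  have Mge: "?d \<le> color G v" if "v \<in> insert k M" for v
    using that MAttr_unfold[of G ?d "{k}"] unfolding M_def mpre_def by blast
  fix v assume v: "v \<in> winning_region G' p"
  then obtain \<sigma>' where \<sigma>': "strategy G' p \<sigma>'"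
    "\<And>\<pi>. play G' \<pi> \<Longrightarrow> \<pi> 0 = v \<Longrightarrow> conforms G' p \<sigma>' \<pi> \<Longrightarrow> wins G' p \<pi>"
    by (rule winning_regionE) blast
  define \<sigma> where "\<sigma> h = (if last (cut k M h) = last h then \<sigma>' (cut k M h) else a (last h))" for h
  show "v \<in> winning_region G p"
  proof (rule winning_regionI[OF G])
    show "v \<in> nodes G"
      using v winning_region_subset_nodes[of G' p] by (auto simp: G'_def)
    fix \<pi> assume \<pi>: "play G \<pi>" "\<pi> 0 = v" "follows G p \<sigma> \<pi>"
    have E: "(\<pi> n, \<pi> (Suc n)) \<in> edges G" for n
      using \<pi>(1) by (simp add: play_def)
    define H where "H n = cut k M (map \<pi> [0..<Suc n])" for n
    have H0: "H 0 = [\<pi> 0]"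
      by (simp add: H_def cut_def cut_step_def)
    have H_Suc: "H (Suc n) = cut_step k M (H n) (\<pi> (Suc n))" for n
      by (simp add: H_def cut_def)
    have H_ne: "H n \<noteq> []" for n
      by (induction n) (auto simp: H0 H_Suc cut_step_def)
    have grow_iff: "H (Suc n) \<noteq> H n \<longleftrightarrow> \<not> (last (H n) = k \<and> \<pi> (Suc n) \<in> insert k M)" for n
      using H_ne[of n] by (auto simp: H_Suc cut_step_def)
    have grow: "H (Suc n) = H n \<or> H (Suc n) = H n @ [\<pi> (Suc n)]" for n
      by (auto simp: H_Suc cut_step_def)
    have inv: "last (H n) = \<pi> n \<or> last (H n) = k \<and> \<pi> n \<in> M" for n
    proof (induction n)
      case 0
      then show ?case by (simp add: H0)
    next
      case (Suc n)
      then show ?case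
        using grow[of n] grow_iff[of n] by (cases "H (Suc n) = H n") auto
    qed
    have \<sigma>H: "\<sigma> (map \<pi> [0..<Suc n]) = (if last (H n) = \<pi> n then \<sigma>' (H n) else a (\<pi> n))" for n
      by (simp add: \<sigma>_def H_def)
    have exc: "\<pi> (Suc n) = a (\<pi> n)"
      if "last (H n) \<noteq> \<pi> n" "\<pi> n \<in> M" "\<pi> n \<in> owned G p" for n
      using followsD[OF \<pi>(3) that(3)] a[OF that(2,3)] that(1) \<sigma>H[of n] by simp
    \<comment> \<open>During an excursion \<open>p\<close> obeys \<open>a\<close>, and the opponent
      can leave the attractor only to \<open>k\<close>; so the next node is in \<open>M\<close> or
      is \<open>k\<close>, and the cut history cannot grow.\<close>
    have regular: "last (H n) = \<pi> n" if "H (Suc n) \<noteq> H n" for n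
    proof (rule ccontr)
      assume ne: "last (H n) \<noteq> \<pi> n"
      then have n: "last (H n) = k" "\<pi> n \<in> M" using inv[of n] by auto
      have "\<pi> (Suc n) \<in> M \<union> {k}"
      proof (cases "\<pi> n \<in> owned G p")
        case True
        then show ?thesis using exc[OF ne n(2)] a[OF n(2)] by simp
      next
        case False
        then show ?thesis
          using MAttr_opponent_stays[OF G, of "\<pi> n" ?d "{k}"] n(2) E[of n]
          unfolding M_def p by blast
      qed
      then show False using that grow_iff[of n] n(1) by blast
    qed
    have regular_foll: "\<pi> (Suc n) = \<sigma>' (H n)" if "last (H n) = \<pi> n" "\<pi> n \<in> owned G p" for n
    proof -
      have "(\<pi> n, \<sigma>' (H n)) \<in> edges G"
        using strategy_edge[OF \<sigma>'(1) H_ne, of n] that by (simp add: owned_G' edges_G')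
      then show ?thesis
        using followsD[OF \<pi>(3) that(2)] \<sigma>H[of n] that(1) by simp
    qed
    have regular_edge: "(\<pi> n, \<pi> (Suc n)) \<in> edges G'" if "H (Suc n) \<noteq> H n" for n
      using that grow_iff[of n] regular[OF that] E[of n] by (auto simp: edges_G')
    have "min_inf_color G \<pi> mod 2 = p"
    proof (cases "\<forall>n. \<exists>m\<ge>n. H (Suc m) \<noteq> H m")
      case False
      \<comment> \<open>The cut history stalls at \<open>k\<close> from \<open>m\<close> on.
        Stalling constrains the next node, so confinement to \<open>M\<close> and \<open>k\<close>
        is claimed from \<open>Suc m\<close>.\<close>
      then obtain m where m: "\<And>n. m \<le> n \<Longrightarrow> last (H n) = k \<and> \<pi> (Suc n) \<in> insert k M"
        using grow_iff by blast
      have "min_inf_color G \<pi> = ?d"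
      proof (rule awin[OF \<pi>(1), of "Suc m"])
        fix n assume "Suc m \<le> n"
        then show "\<pi> n \<in> M \<union> {k}" using m[of "n - 1"] by auto
      next
        fix n assume "Suc m \<le> n" "\<pi> n \<in> M" "\<pi> n \<in> owned G p"
        moreover from this have "last (H n) \<noteq> \<pi> n" using m[of n] kM by auto
        ultimately show "\<pi> (Suc n) = a (\<pi> n)" using exc by blast
      qed
      then show ?thesis by (simp add: p)
    next
      case True
      then obtain t where t: "strict_mono t" "t 0 = 0"
        "\<And>i j. t i \<le> j \<Longrightarrow> j < t (Suc i) \<Longrightarrow> H j = H (t i)"
        "\<And>i. H (t (Suc i)) = H (t i) @ [\<pi> (t (Suc i))]"
        "\<And>i. H (t i) = map (\<lambda>i. \<pi> (t i)) [0..<Suc i]"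
        using growing_lists_subseq[of H \<pi>, OF H0 grow] by blast
      \<comment> \<open>The play \<open>\<pi>\<close> with its excursions cut out.\<close>
      define \<rho> where "\<rho> i = \<pi> (t i)" for i
      have H_t: "H (t i) = map \<rho> [0..<Suc i]" for i
        using t(5)[of i] by (simp add: \<rho>_def)
      have last_H_t: "last (H (t i)) = \<rho> i" for i
        by (simp add: H_t)
      have step: "(\<rho> i, \<rho> (Suc i)) \<in> edges G' \<and>
          (\<rho> i \<in> owned G p \<longrightarrow> \<rho> (Suc i) = \<sigma>' (map \<rho> [0..<Suc i]))" for i
      proof -
        have lt: "t i < t (Suc i)" using t(1) by (simp add: strict_mono_Suc_iff)
        \<comment> \<open>The moment just before \<open>\<rho> (Suc i)\<close> is appended: any
          excursion is over, the play is back at \<open>\<rho> i\<close> and makes a move of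
          \<open>G'\<close>.\<close>
        define n where "n = t (Suc i) - 1"
        have n: "Suc n = t (Suc i)" "t i \<le> n" "n < t (Suc i)"
          using lt by (auto simp: n_def)
        have Hn: "H n = H (t i)" using t(3)[OF n(2,3)] .
        then have g: "H (Suc n) \<noteq> H n" using t(4)[of i] n(1) by simp
        have \<pi>n: "\<pi> n = \<rho> i" using regular[OF g] Hn last_H_t by simp
        have \<pi>Sn: "\<pi> (Suc n) = \<rho> (Suc i)" by (simp add: n(1) \<rho>_def)
        show ?thesis
          using regular_edge[OF g] regular_foll[OF regular[OF g]]
          unfolding \<pi>n \<pi>Sn Hn H_t by blast
      qed
      have play': "play G' \<rho>" using step by (simp add: play_def)
      have "conforms G' p \<sigma>' \<rho>"
        using step by (simp add: conforms_def owned_G' del: upt_Suc)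
      moreover have "\<rho> 0 = v" using t(2) \<pi>(2) by (simp add: \<rho>_def)
      ultimately have "wins G' p \<rho>" using \<sigma>'(2) play' by blast
      then have "min_inf_color G \<rho> mod 2 = p"
        using wins_iff[of p G \<rho>] wins_cong[OF color_G'] p by simp
      \<comment> \<open>The least recurring color of \<open>\<rho>\<close> recurs in
        \<open>\<pi>\<close>, since \<open>\<rho>\<close> is a subsequence. Conversely, a color
        recurring in \<open>\<pi>\<close> recurs in \<open>\<rho>\<close> or within excursions; the
        latter needs infinitely many visits of \<open>\<rho>\<close> to \<open>k\<close>, and such a
        color is at least \<open>?d\<close>.\<close>
      moreover have "min_inf_color G \<pi> = min_inf_color G \<rho>"
      proof (rule min_inf_color_eqI)
        have "play G \<rho>" using play' by (auto simp: play_def edges_G')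
        from min_inf_color_INFM[OF G this]
        show "\<exists>\<^sub>\<infinity>n. color G (\<pi> n) = min_inf_color G \<rho>"
          unfolding INFM_nat \<rho>_def
          using strict_mono_imp_increasing[OF t(1)] by (meson order.strict_trans1 less_le_trans)
      next
        fix e assume e: "\<exists>\<^sub>\<infinity>n. color G (\<pi> n) = e"
        have "\<exists>\<^sub>\<infinity>i. color G (\<rho> i) = e \<or> (\<rho> i = k \<and> ?d \<le> e)"
          unfolding INFM_nat
        proof
          fix b
          \<comment> \<open>Going beyond \<open>t (Suc b)\<close> rather than \<open>t b\<close>
            makes the index \<open>i\<close> found below strictly larger than
            \<open>b\<close>.\<close>
          obtain n where n: "t (Suc b) < n" "color G (\<pi> n) = e"
            using e unfolding INFM_nat by blast
          define j where "j = (LEAST j. n < t j)"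
          have "n < t (Suc n)"
            using strict_mono_imp_increasing[OF t(1), of "Suc n"] by simp
          then have j: "n < t j" unfolding j_def by (rule LeastI)
          then obtain i where "j = Suc i" using t(2) by (cases j) auto
          with j have i': "n < t (Suc i)" and i: "t i \<le> n"
            using not_less_Least[of i "\<lambda>j. n < t j"] unfolding j_def[symmetric] by auto
          have "Suc b < Suc i"
            using strict_mono_less[OF t(1)] n(1) i' by (meson order.strict_trans)
          have "color G (\<rho> i) = e \<or> (\<rho> i = k \<and> ?d \<le> e)"
          proof (cases "n = t i")
            case True
            then show ?thesis using n(2) by (simp add: \<rho>_def)
          next
            case False
            \<comment> \<open>The node at \<open>n\<close> was not appended, so the move into it,
              made at \<open>l\<close>, belongs to an excursion from
              \<open>\<rho> i = k\<close>.\<close>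
            define l where "l = n - 1"
            have l: "n = Suc l" "t i \<le> l" "l < t (Suc i)"
              using False i i' by (auto simp: l_def)
            have "H (Suc l) = H l" "last (H l) = \<rho> i"
              using t(3)[of i l] t(3)[of i n] l i i' last_H_t by auto
            then have "\<rho> i = k" "\<pi> n \<in> insert k M" using grow_iff[of l] l(1) by auto
            then show ?thesis using Mge n(2) by blast
          qed
          then show "\<exists>i>b. color G (\<rho> i) = e \<or> (\<rho> i = k \<and> ?d \<le> e)"
            using \<open>Suc b < Suc i\<close> by auto
        qed
        then have "(\<exists>\<^sub>\<infinity>i. color G (\<rho> i) = e) \<or> (\<exists>\<^sub>\<infinity>i. \<rho> i = k \<and> ?d \<le> e)"
          by (simp add: INFM_disj_distrib)
        then show "min_inf_color G \<rho> \<le> e"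
        proof
          assume "\<exists>\<^sub>\<infinity>i. color G (\<rho> i) = e"
          then show ?thesis by (rule min_inf_color_le)
        next
          assume *: "\<exists>\<^sub>\<infinity>i. \<rho> i = k \<and> ?d \<le> e"
          then have "?d \<le> e" by (auto simp: INFM_nat)
          moreover have "\<exists>\<^sub>\<infinity>i. color G (\<rho> i) = ?d"
            using * by (rule INFM_mono) simp
          ultimately show ?thesis using min_inf_color_le order_trans by blast
        qed
      qed
      ultimately show ?thesis by simp
    qed
    moreover have "p < 2" by (simp add: p)
    ultimately show "wins G p \<pi>" using wins_iff by blast
  qed
qed

lemma winning_region_remove_edges:
  assumes "q < 2"
  shows "winning_region G' q \<subseteq> winning_region G q"
proof (cases "k \<in> owned G (color G k mod 2)")
  case True
  then show ?thesis using own_node_no_edges_into_MAttr by simp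
next
  case False
  have "q = color G k mod 2 \<or> q = 1 - color G k mod 2" using assms by auto
  then show ?thesis
    using winning_region_remove_edges_own[OF _ refl] winning_region_remove_edges_opponent False
    by (metis mod_less_divisor zero_less_numeral)
qed

end


section \<open>Soundness\<close>

text \<open>Rule induction over the run, with the game varying: hits restrict it and other steps
  delete edges, both keeping it a parity game. At each step winning regions of the smaller game lift
  to the larger one.\<close>

lemma psol_sound:
  "psol G W R \<Longrightarrow> parity_game G \<Longrightarrow> q < 2 \<Longrightarrow> W q \<subseteq> winning_region G q"
  "psol_loop G ks W R \<Longrightarrow> parity_game G \<Longrightarrow> q < 2 \<Longrightarrow> W q \<subseteq> winning_region G q"
proof (induction rule: psol_psol_loop.inducts)
  case (psol_hit k G p A W R ks)
  have M: "MAttr_node G k \<subseteq> winning_region G p"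
    unfolding psol_hit.hyps(2)
    by (rule MAttr_subset_winning_region) (use psol_hit in auto)
  show ?case
    unfolding psol_hit.hyps(3)
  proof (rule classify_Attr_sound[OF psol_hit.prems(1) _ psol_hit.prems(2) M])
    show "p < 2" by (simp add: psol_hit.hyps(2))
    show "W q \<subseteq> winning_region (subgame G (Attr G p (MAttr_node G k))) q"
      using psol_hit.IH parity_game_subgame_Attr psol_hit.prems(1,2) unfolding psol_hit.hyps(3) by blast
  qed
next
  case (psol_edges k G ks W R)
  then show ?case
    using parity_game_remove_edges[OF _ psol_edges.hyps(1) refl refl]
      winning_region_remove_edges[OF _ psol_edges.hyps(1) refl refl] by blast
qed auto

text \<open>The premise on the colors of \<open>X\<close> is the invariant of the shrinking loop:
  \<open>X\<close> starts as a color class and only loses nodes, so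
  \<open>MAttr_subset_winning_region\<close> applies at a hit.\<close>

lemma psolB_sound:
  "psolB G W R \<Longrightarrow> parity_game G \<Longrightarrow> q < 2 \<Longrightarrow> W q \<subseteq> winning_region G q"
  "psolB_loop G ds W R \<Longrightarrow> parity_game G \<Longrightarrow> q < 2 \<Longrightarrow> W q \<subseteq> winning_region G q"
  "psolB_color G d X ds W R \<Longrightarrow> parity_game G \<Longrightarrow> q < 2 \<Longrightarrow>
     (\<And>v. v \<in> X \<Longrightarrow> color G v = d) \<Longrightarrow> W q \<subseteq> winning_region G q"
proof (induction rule: psolB_psolB_loop_psolB_color.inducts)
  case (psolB_hit X G d p A W R ds)
  have M: "MAttr G d X \<subseteq> winning_region G p"
    unfolding psolB_hit.hyps(3)
    by (rule MAttr_subset_winning_region) (use psolB_hit in auto)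
  show ?case
    unfolding psolB_hit.hyps(4)
  proof (rule classify_Attr_sound[OF psolB_hit.prems(1) _ psolB_hit.prems(2) M])
    show "p < 2" by (simp add: psolB_hit.hyps(3))
    show "W q \<subseteq> winning_region (subgame G (Attr G p (MAttr G d X))) q"
      using psolB_hit.IH parity_game_subgame_Attr psolB_hit.prems(1,2) unfolding psolB_hit.hyps(4) by blast
  qed
qed auto

theorem theorem3:
  fixes G :: "'a game"
  assumes "parity_game G"
  shows "Win_psol G 0 \<subseteq> winning_region G 0 \<and> Win_psolB G 0 \<subseteq> winning_region G 0 \<and>
         Win_psol G 1 \<subseteq> winning_region G 1 \<and> Win_psolB G 1 \<subseteq> winning_region G 1"
proof -
  have "Win_psol G q \<subseteq> winning_region G q" "Win_psolB G q \<subseteq> winning_region G q" if "q < 2" for q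
    unfolding Win_psol_def Win_psolB_def
    using psol_sound(1)[OF _ assms that] psolB_sound(1)[OF _ assms that] by blast+
  then show ?thesis by simp
qed

end
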